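(* Let $A(n,k)$ denote the Eulerian numbers. Then $$\sum_{n\ge0}A(2n,n+1)z^n=14+3\left(3z^2-4z+2\right)\Psi(z)+\left(21z^3+20z^2+13z+23\right)\Psi^3(z)+3\left(6z^4+4z^3+3z^2+4\right)\Psi^5(z)\quad\text{modulo }27.$$
   Context: $A(n,k)$ is the number of permutations of $\{1,\dots,n\}$ with exactly $k-1$ descents; equivalently $A(n,k)=\sum_{j=0}^{k}(-1)^{k-j}\binom{n+1}{k-j}j^n$ (with $A(0,1)=1$). $\Psi(z)=\prod_{j\ge0}(1+z^{3^j})$. "Modulo $27$" means all coefficients of the difference of the two power series in $z$ are divisible by $27$. *)

theory Defs
  imports "HOL-Computational_Algebra.Formal_Power_Series"
begin

(* Eulerian number A(n,k): number of permutations of {1..n} with exactly k-1 descents,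
   given by the explicit formula, with the convention A(0,1) = 1. *)
definition eulerian :: "nat \<Rightarrow> nat \<Rightarrow> int" where
  "eulerian n k = (if n = 0 then (if k = 1 then 1 else 0)
     else (\<Sum>j=0..k. (-1) ^ (k - j) * int ((n + 1) choose (k - j)) * int j ^ n))"

(* Psi(z) = prod_{j>=0} (1 + z^(3^j)); the coefficient of z^m is determined by the
   finite partial product over j <= m (since 3^j > m for j > m). *)
definition Psi :: "int fps" where
  "Psi = Abs_fps (\<lambda>m. fps_nth (\<Prod>j\<le>m. (1 + fps_X ^ (3 ^ j))) m)"

end

theory Submission
  imports Defs
begin

text \<open>
  Let \<open>v = (1 + 4z)\<^bsup>-1/2\<^esup> = \<Sum>\<^sub>n (-1)\<^sup>n (2n choose n) z\<^sup>n\<close>. Modulo 3 both \<open>(1 + z) \<Psi>\<^sup>2\<close> and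
  \<open>(1 + z) v\<^sup>2\<close> are 1, so \<open>\<Psi> = v + 3f\<close>; in the right-hand side of the theorem the terms linear
  in \<open>f\<close> cancel modulo 27, hence \<open>\<Psi>\<close> may be replaced by \<open>v\<close>.

  For the left-hand side, \<open>j\<^bsup>2n\<^esup> = (1 + (j\<^sup>2 - 1))\<^sup>n\<close> is, modulo 27, quadratic in \<open>n\<close> when 3 does not
  divide \<open>j\<close>, and it vanishes for the multiples of 3 that occur. The remaining half-range alternating
  sums \<open>\<Sum>\<^bsub>j\<ge>1\<^esub> (-1)\<^bsup>n+1-j\<^esup> (2n+1 choose n+1-j) p(j)\<close> of an even function \<open>p\<close> with \<open>p(0) = 0\<close> have
  generating function \<open>(1 + 1/v) / (4z)\<close> times that of the iterated central differences
  \<open>\<delta>\<^bsup>2n\<^esup> p(0)\<close>, and the latter is rational with denominator a power of \<open>1 + 3z\<close> when \<open>p\<close> is a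
  polynomial multiplied by the indicator function of the non-multiples of 3. The powers of \<open>n\<close>
  become derivatives, and everything reduces to identities between polynomials in \<open>z\<close> and \<open>v\<close>.
\<close>

section \<open>Divisibility of integer power series by constants\<close>

lemma fps_const_dvd_iff:
  fixes f :: "'a::comm_ring_1 fps"
  shows "fps_const c dvd f \<longleftrightarrow> (\<forall>n. c dvd fps_nth f n)"
proof
  assume "fps_const c dvd f"
  then show "\<forall>n. c dvd fps_nth f n" by (auto elim!: dvdE)
next
  assume "\<forall>n. c dvd fps_nth f n"
  then obtain g where "\<forall>n. fps_nth f n = c * g n" unfolding dvd_def by metis
  then have "f = fps_const c * Abs_fps g" by (simp add: fps_eq_iff)
  then show "fps_const c dvd f" by simp
qed

lemma fps_numeral_dvd_iff:
  fixes f :: "'a::comm_ring_1 fps"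
  shows "numeral k dvd f \<longleftrightarrow> (\<forall>n. numeral k dvd fps_nth f n)"
  by (simp only: numeral_fps_const fps_const_dvd_iff)

text \<open>A series with constant term coprime to \<open>k\<close> is a unit modulo
  \<open>k\<close>: coefficient n of \<open>g * f\<close> is \<open>g(0) f(n)\<close> plus terms
  containing lower coefficients of \<open>f\<close>. This clears constants and the denominators 1 +
  3z and 1 + 4z.\<close>

lemma fps_numeral_dvd_mult_cancel:
  fixes f g :: "int fps"
  assumes "numeral k dvd g * f" "coprime (numeral k) (fps_nth g 0)"
  shows "numeral k dvd f"
proof -
  have "numeral k dvd fps_nth f n" for n
  proof (induction n rule: less_induct)
    case (less n)
    have "fps_nth (g * f) n = fps_nth g 0 * fps_nth f n + (\<Sum>i=1..n. fps_nth g i * fps_nth f (n - i))"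
      by (simp add: fps_mult_nth sum.atLeast_Suc_atMost)
    moreover have "numeral k dvd (\<Sum>i=1..n. fps_nth g i * fps_nth f (n - i))"
      by (intro dvd_sum dvd_mult less) auto
    moreover have "numeral k dvd fps_nth (g * f) n"
      using assms(1) by (simp add: fps_numeral_dvd_iff)
    ultimately have "numeral k dvd fps_nth g 0 * fps_nth f n"
      by (metis dvd_add_left_iff)
    then show ?case using assms(2) coprime_dvd_mult_right_iff by blast
  qed
  then show ?thesis by (simp add: fps_numeral_dvd_iff)
qed

lemma fps_numeral_dvd_X_mult_cancel:
  fixes f :: "int fps"
  assumes "numeral k dvd fps_X * f"
  shows "numeral k dvd f"
proof -
  have "numeral k dvd fps_nth (fps_X * f) (Suc n)" for n
    using assms unfolding fps_numeral_dvd_iff by blast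
  then show ?thesis by (simp add: fps_numeral_dvd_iff)
qed

section \<open>The series of alternating central binomial coefficients\<close>

definition cbin :: "int fps" where
  "cbin = Abs_fps (\<lambda>n. (-1) ^ n * int ((2 * n) choose n))"

lemma central_choose_Suc:
  "(2 * Suc n) choose Suc n = 2 * ((2 * n + 1) choose n)"
  using binomial_symmetric[of n "2 * n + 1"] by (simp add: mult_2)

lemma central_choose_Suc_mult:
  "Suc n * ((2 * Suc n) choose Suc n) = 2 * (2 * n + 1) * ((2 * n) choose n)"
proof -
  have "Suc n * ((2 * n + 1) choose n) = (2 * n + 1) * ((2 * n) choose n)"
    using Suc_times_binomial_eq[of "2 * n" n] binomial_symmetric[of n "2 * n + 1"]
    by (simp add: mult.commute)
  then show ?thesis unfolding central_choose_Suc by (metis mult.assoc mult.left_commute)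
qed

lemma cbin_nth_0: "fps_nth cbin 0 = 1"
  by (simp add: cbin_def)

lemma cbin_nth_Suc: "fps_nth cbin (Suc n) = - 2 * (-1) ^ n * int ((2 * n + 1) choose n)"
  using central_choose_Suc[of n] by (simp add: cbin_def)

text \<open>Series form of the recurrence (n+1) c(n+1) = -2(2n+1) c(n) for the coefficients.\<close>

lemma cbin_ode: "(1 + 4 * fps_X) * fps_deriv cbin = - 2 * cbin"
proof (rule fps_ext)
  fix n
  have rec: "int (Suc n) * fps_nth cbin (Suc n) = - 2 * (2 * int n + 1) * fps_nth cbin n" for n
  proof -
    have "int (Suc n) * int ((2 * Suc n) choose Suc n) = 2 * (2 * int n + 1) * int ((2 * n) choose n)"
      using arg_cong[OF central_choose_Suc_mult[of n], of int]
      by (simp only: of_nat_mult of_nat_add of_nat_numeral of_nat_1)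
    then have "(-1) ^ Suc n * (int (Suc n) * int ((2 * Suc n) choose Suc n))
        = (-1) ^ Suc n * (2 * (2 * int n + 1) * int ((2 * n) choose n))"
      by (rule arg_cong)
    then show ?thesis unfolding cbin_def fps_nth_Abs_fps
      by (simp only: mult.left_commute power_Suc mult_minus1 mult_minus_left mult_minus_right)
  qed
  show "fps_nth ((1 + 4 * fps_X) * fps_deriv cbin) n = fps_nth (- 2 * cbin) n"
    using rec[of n] rec[of "n - 1"]
    by (cases n) (simp_all add: distrib_right mult.assoc numeral_fps_const fps_const_neg[symmetric] del: fps_const_neg, simp_all add: algebra_simps)
qed

lemma cbin_square: "(1 + 4 * fps_X) * cbin ^ 2 = 1"
proof -
  \<comment> \<open>By the differential equation the product has derivative 0, so it equals its
    constant term 1.\<close>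
  have "fps_deriv ((1 + 4 * fps_X) * cbin ^ 2) = 4 * cbin ^ 2 + 2 * cbin * ((1 + 4 * fps_X) * fps_deriv cbin)"
    by (simp add: power2_eq_square algebra_simps)
  also have "\<dots> = 0" unfolding cbin_ode by (simp add: power2_eq_square)
  finally have "(1 + 4 * fps_X) * cbin ^ 2 = fps_const (fps_nth ((1 + 4 * fps_X) * cbin ^ 2) 0)"
    by (simp only: fps_deriv_eq_0_iff)
  then show ?thesis by (simp add: cbin_nth_0 fps_nth_power_0)
qed

lemma cbin_deriv: "fps_deriv cbin = - 2 * cbin ^ 3"
proof -
  have "fps_deriv cbin = cbin ^ 2 * ((1 + 4 * fps_X) * fps_deriv cbin)"
    using cbin_square by (metis mult.assoc mult.commute mult_1)
  then show ?thesis unfolding cbin_ode by (simp add: power2_eq_square power3_eq_cube)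
qed

section \<open>Reduction of Psi\<close>

text \<open>Factors of index above \<open>k\<close> leave coefficient \<open>k\<close> alone because
  k < 3^(k+1), so every longer partial product may be used.\<close>

lemma Psi_nth: "k \<le> m \<Longrightarrow> fps_nth Psi k = fps_nth (\<Prod>j\<le>m. (1 + fps_X ^ (3 ^ j))) k"
proof (induction m rule: dec_induct)
  case base
  then show ?case by (simp add: Psi_def)
next
  case (step m)
  have "m < 3 ^ Suc m" using power_gt_expt[of 3 "Suc m"] by simp
  with step have "k < 3 ^ Suc m" by linarith
  with step show ?case by (simp add: distrib_left fps_X_power_mult_right_nth del: power_Suc)
qed

text \<open>Telescoping through (1 + y)^3 = 1 + y^3 modulo 3, with y = z^(3^(m+1)): a new squared
  factor (1 + y)^2 meets the 1 + y left from the previous stage.\<close>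

lemma partial_prod_square_mod_3:
  "(3 :: int fps) dvd (1 + fps_X) * (\<Prod>j\<le>m. (1 + fps_X ^ (3 ^ j))) ^ 2 - (1 + fps_X ^ (3 ^ Suc m))"
proof (induction m)
  case 0
  have "(1 + fps_X) * (1 + fps_X) ^ 2 - (1 + fps_X ^ 3) = 3 * (fps_X + fps_X ^ 2 :: int fps)"
    by algebra
  then show ?case by simp
next
  case (Suc m)
  define y :: "int fps" where "y = fps_X ^ (3 ^ Suc m)"
  define p :: "int fps" where "p = (\<Prod>j\<le>m. (1 + fps_X ^ (3 ^ j)))"
  obtain h where "(1 + fps_X) * p ^ 2 - (1 + y) = 3 * h"
    using Suc unfolding y_def p_def by (auto elim: dvdE)
  then have "(1 + fps_X) * (p * (1 + y)) ^ 2 - (1 + y ^ 3) = 3 * (h * (1 + y) ^ 2 + y + y ^ 2)"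
    by algebra
  moreover have "y ^ 3 = fps_X ^ (3 ^ Suc (Suc m))"
    by (simp add: y_def power_mult[symmetric] mult.commute)
  ultimately show ?case by (simp add: p_def y_def del: power_Suc)
qed

lemma Psi_square_mod_3: "(3 :: int fps) dvd (1 + fps_X) * Psi ^ 2 - 1"
proof -
  have "3 dvd fps_nth ((1 + fps_X) * Psi ^ 2 - 1) m" for m
  proof -
    let ?P = "\<Prod>j\<le>m. (1 + fps_X ^ (3 ^ j)) :: int fps"
    have sq: "fps_nth (Psi ^ 2) k = fps_nth (?P ^ 2) k" if "k \<le> m" for k
      unfolding power2_eq_square fps_mult_nth using that by (intro sum.cong) (simp_all add: Psi_nth[of _ m])
    have "fps_nth ((1 + fps_X) * Psi ^ 2) m = fps_nth ((1 + fps_X) * ?P ^ 2) m"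
      unfolding fps_mult_nth by (intro sum.cong) (simp_all add: sq)
    moreover have "m < 3 ^ Suc m"
      using power_gt_expt[of 3 "Suc m"] by simp
    then have "fps_nth (1 + fps_X ^ (3 ^ Suc m) :: int fps) m = fps_nth 1 m"
      by (simp add: fps_X_power_nth del: power_Suc)
    moreover have "3 dvd fps_nth ((1 + fps_X) * ?P ^ 2 - (1 + fps_X ^ (3 ^ Suc m))) m"
      using partial_prod_square_mod_3[of m] unfolding fps_numeral_dvd_iff by blast
    ultimately show ?thesis by (simp only: fps_sub_nth)
  qed
  then show ?thesis by (simp only: fps_numeral_dvd_iff simp_thms)
qed

text \<open>The squares agree modulo 3, so (\<open>Psi\<close> +
  \<open>cbin\<close>)(\<open>Psi\<close> - \<open>cbin\<close>) vanishes modulo 3. The first factor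
  has constant term 2, hence is a unit.\<close>

lemma Psi_cbin_mod_3: "(3 :: int fps) dvd Psi - cbin"
proof -
  obtain h where "(1 + fps_X) * Psi ^ 2 - 1 = 3 * h"
    using Psi_square_mod_3 by (auto elim: dvdE)
  then have "((1 + fps_X) * (Psi + cbin)) * (Psi - cbin) = 3 * (h + fps_X * cbin ^ 2)"
    using cbin_square by algebra
  then have "3 dvd ((1 + fps_X) * (Psi + cbin)) * (Psi - cbin)" by simp
  moreover have "coprime 3 (fps_nth ((1 + fps_X) * (Psi + cbin)) 0)"
    by (simp add: cbin_nth_0 Psi_nth[of 0 0])
  ultimately show ?thesis by (rule fps_numeral_dvd_mult_cancel)
qed

text \<open>With u = v + 3f the part linear in f is 9f(a + b v^2 + 5c v^4), and the second
  assumption supplies the missing factor 3. Terms of higher order in f already carry 27.\<close>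

lemma quintic_combination_mod_27:
  fixes a b c u v :: "int fps"
  assumes "3 dvd u - v" "3 dvd a + b * v ^ 2 + 5 * c * v ^ 4"
  shows "27 dvd (3 * a * u + b * u ^ 3 + 3 * c * u ^ 5) - (3 * a * v + b * v ^ 3 + 3 * c * v ^ 5)"
proof -
  obtain f where f: "u = v + 3 * f" using assms(1) by (metis dvdE diff_add_cancel add.commute)
  obtain g where g: "a + b * v ^ 2 + 5 * c * v ^ 4 = 3 * g" using assms(2) by (auto elim: dvdE)
  have "(3 * a * u + b * u ^ 3 + 3 * c * u ^ 5) - (3 * a * v + b * v ^ 3 + 3 * c * v ^ 5)
     = 9 * f * (a + b * v ^ 2 + 5 * c * v ^ 4)
      + 27 * (b * v * f ^ 2 + b * f ^ 3 + c * (10 * v ^ 3 * f ^ 2 + 30 * v ^ 2 * f ^ 3 + 45 * v * f ^ 4 + 27 * f ^ 5))"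
    unfolding f by algebra
  then show ?thesis unfolding g by simp
qed


section \<open>Central differences\<close>

definition cdiff2 :: "(int \<Rightarrow> int) \<Rightarrow> int \<Rightarrow> int" where
  "cdiff2 p j = p (j + 1) - 2 * p j + p (j - 1)"

definition cdiff_fps :: "(int \<Rightarrow> int) \<Rightarrow> int fps" where
  "cdiff_fps p = Abs_fps (\<lambda>n. (cdiff2 ^^ n) p 0)"

lemma cdiff_fps_rec: "cdiff_fps p = fps_const (p 0) + fps_X * cdiff_fps (cdiff2 p)"
proof (rule fps_ext)
  fix n
  show "fps_nth (cdiff_fps p) n = fps_nth (fps_const (p 0) + fps_X * cdiff_fps (cdiff2 p)) n"
    by (cases n) (simp_all add: cdiff_fps_def funpow_swap1)
qed

lemma cdiff_fps_add: "cdiff_fps (\<lambda>j. p j + q j) = cdiff_fps p + cdiff_fps q"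
proof -
  have "(cdiff2 ^^ n) (\<lambda>j. p j + q j) = (\<lambda>j. (cdiff2 ^^ n) p j + (cdiff2 ^^ n) q j)" for n
    by (induction n) (auto simp: cdiff2_def fun_eq_iff)
  then show ?thesis by (simp add: cdiff_fps_def fps_eq_iff)
qed

lemma cdiff_fps_cmult: "cdiff_fps (\<lambda>j. c * p j) = fps_const c * cdiff_fps p"
proof -
  have "(cdiff2 ^^ n) (\<lambda>j. c * p j) = (\<lambda>j. c * (cdiff2 ^^ n) p j)" for n
    by (induction n) (auto simp: cdiff2_def fun_eq_iff algebra_simps)
  then show ?thesis by (simp add: cdiff_fps_def fps_eq_iff)
qed

lemma cdiff_fps_const: "cdiff_fps (\<lambda>_. c) = fps_const c"
proof -
  \<comment> \<open>The zero function is written as a product so that \<open>cdiff_fps_cmult\<close>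
    with factor 0 matches it.\<close>
  have "cdiff2 (\<lambda>_. c) = (\<lambda>_. 0 * 0)" by (simp add: cdiff2_def fun_eq_iff)
  then show ?thesis using cdiff_fps_rec[of "\<lambda>_. c"] cdiff_fps_cmult[of 0 "\<lambda>_. 0"] by simp
qed

text \<open>The sum over \<open>j \<ge> 1\<close> of the header, reindexed by \<open>i = n + 1 - j\<close>.\<close>

definition half_alt_fps :: "(int \<Rightarrow> int) \<Rightarrow> int fps" where
  "half_alt_fps p =
    Abs_fps (\<lambda>n. \<Sum>i\<le>n. (-1) ^ i * int ((2 * n + 1) choose i) * p (int n + 1 - int i))"

text \<open>Summation by parts via Pascal's rule; the last term is the boundary contribution of the
  truncated sum.\<close>

lemma alternating_sum_Suc_choose:
  fixes f :: "nat \<Rightarrow> int"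
  shows "(\<Sum>i\<le>k. (-1) ^ i * int (Suc m choose i) * f i) =
    (\<Sum>i\<le>k. (-1) ^ i * int (m choose i) * (f i - f (Suc i))) + (-1) ^ k * int (m choose k) * f (Suc k)"
  by (induction k) (simp_all add: algebra_simps)

text \<open>Summation by parts twice takes row 2n+3 to row 2n+1 and turns \<open>p\<close> into
  \<open>cdiff2 p\<close>; the boundary terms sit in the middle of the row.\<close>

lemma half_alt_fps_nth_Suc:
  assumes "\<And>j. p (- j) = p j"
  shows "fps_nth (half_alt_fps p) (Suc n) =
    fps_nth (half_alt_fps (cdiff2 p)) n - (-1) ^ n * int ((2 * n + 1) choose n) * (p 1 + p 0)"
proof -
  define f where "f i = p (int n + 2 - int i)" for i
  define g where "g i = f i - f (Suc i)" for i
  define c where "c = int ((2 * n + 1) choose n)"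
  have c1: "int ((2 * n + 1) choose Suc n) = c"
    using binomial_symmetric[of n "2 * n + 1"] by (simp add: c_def)
  have c2: "int ((2 * n + 2) choose Suc n) = 2 * c"
    using central_choose_Suc[of n] by (simp add: c_def)
  have h: "g i - g (Suc i) = cdiff2 p (int n + 1 - int i)" for i
    by (simp add: g_def f_def cdiff2_def algebra_simps)
  have "fps_nth (half_alt_fps p) (Suc n) = (\<Sum>i\<le>Suc n. (-1) ^ i * int (Suc (2 * n + 2) choose i) * f i)"
    unfolding half_alt_fps_def f_def fps_nth_Abs_fps by (intro sum.cong) (simp_all add: algebra_simps)
  also have "\<dots> = (\<Sum>i\<le>Suc n. (-1) ^ i * int (Suc (2 * n + 1) choose i) * g i)
      + (-1) ^ Suc n * (2 * c) * f (Suc (Suc n))"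
    unfolding alternating_sum_Suc_choose[where m = "2 * n + 2" and f = f] c2 g_def by simp
  also have "\<dots> = (\<Sum>i\<le>Suc n. (-1) ^ i * int ((2 * n + 1) choose i) * cdiff2 p (int n + 1 - int i))
      + (-1) ^ Suc n * c * g (Suc (Suc n)) + (-1) ^ Suc n * (2 * c) * f (Suc (Suc n))"
    unfolding alternating_sum_Suc_choose[where m = "2 * n + 1" and f = g] c1 h by (rule refl)
  \<comment> \<open>The sum has one term more than coefficient n of
    \<open>half_alt_fps (cdiff2 p)\<close>: at i = n+1 the argument is 0, giving
    \<open>c * cdiff2 p 0\<close>.\<close>
  also have "\<dots> = fps_nth (half_alt_fps (cdiff2 p)) n
      + (-1) ^ Suc n * (c * cdiff2 p 0 + c * g (Suc (Suc n)) + 2 * c * f (Suc (Suc n)))"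
    unfolding sum.atMost_Suc c1 by (simp add: half_alt_fps_def algebra_simps)
  also have "c * cdiff2 p 0 + c * g (Suc (Suc n)) + 2 * c * f (Suc (Suc n)) = c * (p 1 + p 0)"
    using assms[of 1] by (simp add: g_def f_def cdiff2_def algebra_simps)
  finally show ?thesis by (simp add: c_def)
qed

text \<open>Both sides obey the same recursion under \<open>p \<mapsto> cdiff2 p\<close>, which lowers \<open>n\<close> by one.\<close>

lemma half_alt_fps_nth_eq:
  assumes "\<And>j. p (- j) = p j"
  shows "4 * fps_nth (half_alt_fps p) n =
    fps_nth ((1 + (1 + 4 * fps_X) * cbin) * cdiff_fps (cdiff2 p)) n + 4 * p 0 * fps_nth cbin n"
  using assms
proof (induction n arbitrary: p)
  case 0
  have "cdiff2 p 0 = 2 * p 1 - 2 * p 0" using 0[of 1] by (simp add: cdiff2_def)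
  then show ?case by (simp add: half_alt_fps_def cdiff_fps_def cbin_nth_0)
next
  case (Suc n)
  let ?W = "1 + (1 + 4 * fps_X) * cbin"
  have even: "cdiff2 p (- j) = cdiff2 p j" for j
    using Suc.prems[of "j - 1"] Suc.prems[of j] Suc.prems[of "j + 1"] by (simp add: cdiff2_def)
  have d0: "cdiff2 p 0 = 2 * p 1 - 2 * p 0" using Suc.prems[of 1] by (simp add: cdiff2_def)
  have W: "fps_nth ?W (Suc n) = fps_nth cbin (Suc n) + 4 * fps_nth cbin n"
    by (simp add: distrib_right mult.assoc numeral_fps_const)
  have "?W * cdiff_fps (cdiff2 p) =
      fps_const (cdiff2 p 0) * ?W + fps_X * (?W * cdiff_fps (cdiff2 (cdiff2 p)))"
    by (subst cdiff_fps_rec) (simp only: algebra_simps)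
  then have "fps_nth (?W * cdiff_fps (cdiff2 p)) (Suc n) =
      cdiff2 p 0 * fps_nth ?W (Suc n) + fps_nth (?W * cdiff_fps (cdiff2 (cdiff2 p))) n"
    by (simp only: fps_add_nth fps_mult_left_const_nth fps_X_mult_nth) simp
  moreover have "fps_nth cbin (Suc n) = - 2 * ((-1) ^ n * int ((2 * n + 1) choose n))"
    by (simp add: cbin_nth_Suc)
  \<comment> \<open>What remains is (\<open>cdiff2 p 0\<close> + 4 \<open>p 0\<close>) times
    coefficient n+1 of \<open>cbin\<close>. The first factor is 2(\<open>p 1\<close> +
    \<open>p 0\<close>), and this matches the boundary term.\<close>
  ultimately show ?case
    unfolding half_alt_fps_nth_Suc[of p, OF Suc.prems] right_diff_distrib Suc.IH[of "cdiff2 p", OF even] W d0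
    by (simp add: algebra_simps)
qed

text \<open>Here (1 + 4z) \<open>cbin\<close> is 1/\<open>cbin\<close>. Since
  \<open>p 0 = 0\<close>, \<open>cdiff_fps p\<close> is z times \<open>cdiff_fps (cdiff2 p)\<close>,
  so the latter avoids a division by z.\<close>

lemma half_alt_fps_eq:
  assumes "\<And>j. p (- j) = p j" "p 0 = 0"
  shows "4 * half_alt_fps p = (1 + (1 + 4 * fps_X) * cbin) * cdiff_fps (cdiff2 p)"
  by (rule fps_ext) (use half_alt_fps_nth_eq[of p, OF assms(1)] assms(2) in \<open>simp add: numeral_fps_const\<close>)

lemma half_alt_fps_mod_27:
  assumes "\<And>j. p (- j) = p j" "p 0 = 0" "27 dvd cdiff_fps p - 2 * fps_X * r"
  shows "27 dvd 2 * half_alt_fps p - (1 + (1 + 4 * fps_X) * cbin) * r"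
proof -
  have "cdiff_fps p - 2 * fps_X * r = fps_X * (cdiff_fps (cdiff2 p) - 2 * r)"
    by (subst cdiff_fps_rec) (simp add: assms(2) algebra_simps)
  then have "27 dvd cdiff_fps (cdiff2 p) - 2 * r"
    using assms(3) fps_numeral_dvd_X_mult_cancel by metis
  then obtain h where "cdiff_fps (cdiff2 p) = 2 * r + 27 * h"
    by (metis dvdE diff_add_cancel add.commute)
  then have "2 * (2 * half_alt_fps p - (1 + (1 + 4 * fps_X) * cbin) * r) =
      27 * ((1 + (1 + 4 * fps_X) * cbin) * h)"
    using half_alt_fps_eq[of p, OF assms(1,2)] by algebra
  then have "27 dvd 2 * (2 * half_alt_fps p - (1 + (1 + 4 * fps_X) * cbin) * r)" by simp
  then show ?thesis by (rule fps_numeral_dvd_mult_cancel) (simp add: numeral_fps_const)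
qed

section \<open>Differences of quasi-polynomials of period 3\<close>

definition nd3 :: "int \<Rightarrow> int" where
  "nd3 j = (if 3 dvd j then 0 else 1)"

text \<open>The odd Dirichlet character modulo 3. It equals
  \<open>nd3 (j + 1) - nd3 (j - 1)\<close>, and so enters the differences of
  \<open>j ^ 2 * nd3 j\<close>.\<close>

definition chi3 :: "int \<Rightarrow> int" where
  "chi3 j = (j + 1) mod 3 - 1"

lemma nd3_chi3_cases:
  obtains "nd3 j = 0" "chi3 j = 0" "nd3 (j + 1) = 1" "chi3 (j + 1) = 1" "nd3 (j - 1) = 1" "chi3 (j - 1) = - 1"
  | "nd3 j = 1" "chi3 j = 1" "nd3 (j + 1) = 1" "chi3 (j + 1) = - 1" "nd3 (j - 1) = 0" "chi3 (j - 1) = 0"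
  | "nd3 j = 1" "chi3 j = - 1" "nd3 (j + 1) = 0" "chi3 (j + 1) = 0" "nd3 (j - 1) = 1" "chi3 (j - 1) = 1"
proof -
  have "j mod 3 = 0 \<or> j mod 3 = 1 \<or> j mod 3 = 2" by presburger
  then show thesis
  proof (elim disjE)
    assume "j mod 3 = 0"
    then show thesis by (intro that(1)) (simp_all add: nd3_def chi3_def, presburger+)
  next
    assume "j mod 3 = 1"
    then show thesis by (intro that(2)) (simp_all add: nd3_def chi3_def, presburger+)
  next
    assume "j mod 3 = 2"
    then show thesis by (intro that(3)) (simp_all add: nd3_def chi3_def, presburger+)
  qed
qed

lemma cdiff2_power2: "cdiff2 (\<lambda>j. j ^ 2) = (\<lambda>_. 2)"
  by (simp add: cdiff2_def fun_eq_iff power2_eq_square algebra_simps)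

lemma cdiff2_power4: "cdiff2 (\<lambda>j. j ^ 4) = (\<lambda>j. 12 * j ^ 2 + 2)"
  unfolding cdiff2_def fun_eq_iff by (intro allI, algebra)

text \<open>Exactly two of three consecutive integers are prime to 3. In this and the next four
  lemmas the function recurs with factor -3, the source of the denominators 1 + 3z; the nested sums
  fit the linearity rules of \<open>cdiff_fps\<close>.\<close>

lemma cdiff2_nd3: "cdiff2 nd3 = (\<lambda>j. 2 + (-3) * nd3 j)"
proof
  fix j show "cdiff2 nd3 j = 2 + (-3) * nd3 j"
    by (cases rule: nd3_chi3_cases[of j]) (simp_all add: cdiff2_def)
qed

lemma cdiff2_chi3: "cdiff2 (\<lambda>j. j * chi3 j) = (\<lambda>j. 2 + ((-3) * nd3 j + (-3) * (j * chi3 j)))"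
proof
  fix j show "cdiff2 (\<lambda>j. j * chi3 j) j = 2 + ((-3) * nd3 j + (-3) * (j * chi3 j))"
    by (cases rule: nd3_chi3_cases[of j]) (simp_all add: cdiff2_def algebra_simps)
qed

lemma cdiff2_power2_nd3:
  "cdiff2 (\<lambda>j. j ^ 2 * nd3 j) =
    (\<lambda>j. 2 * j ^ 2 + ((-3) * (j ^ 2 * nd3 j) + (2 * (j * chi3 j) + (2 + (-1) * nd3 j))))"
proof
  fix j show "cdiff2 (\<lambda>j. j ^ 2 * nd3 j) j =
      2 * j ^ 2 + ((-3) * (j ^ 2 * nd3 j) + (2 * (j * chi3 j) + (2 + (-1) * nd3 j)))"
    by (cases rule: nd3_chi3_cases[of j])
      (simp_all add: cdiff2_def power2_eq_square algebra_simps)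
qed

lemma cdiff2_power3_chi3:
  "cdiff2 (\<lambda>j. j ^ 3 * chi3 j) =
    (\<lambda>j. (-3) * (j ^ 3 * chi3 j) + ((-3) * (j * chi3 j)
      + (6 * j ^ 2 + ((-9) * (j ^ 2 * nd3 j) + (2 + (-3) * nd3 j)))))"
proof
  fix j show "cdiff2 (\<lambda>j. j ^ 3 * chi3 j) j =
      (-3) * (j ^ 3 * chi3 j) + ((-3) * (j * chi3 j)
      + (6 * j ^ 2 + ((-9) * (j ^ 2 * nd3 j) + (2 + (-3) * nd3 j))))"
    by (cases rule: nd3_chi3_cases[of j])
      (simp_all add: cdiff2_def power2_eq_square power3_eq_cube algebra_simps)
qed

lemma cdiff2_power4_nd3:
  "cdiff2 (\<lambda>j. j ^ 4 * nd3 j) =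
    (\<lambda>j. 2 * j ^ 4 + (12 * j ^ 2 + (2 + ((-3) * (j ^ 4 * nd3 j) + ((-6) * (j ^ 2 * nd3 j)
      + ((-1) * nd3 j + (4 * (j ^ 3 * chi3 j) + 4 * (j * chi3 j))))))))"
proof
  fix j show "cdiff2 (\<lambda>j. j ^ 4 * nd3 j) j =
      2 * j ^ 4 + (12 * j ^ 2 + (2 + ((-3) * (j ^ 4 * nd3 j) + ((-6) * (j ^ 2 * nd3 j)
      + ((-1) * nd3 j + (4 * (j ^ 3 * chi3 j) + 4 * (j * chi3 j)))))))"
    by (cases rule: nd3_chi3_cases[of j])
      (simp_all add: cdiff2_def power2_eq_square power3_eq_cube power4_eq_xxxx algebra_simps)
qed

lemmas cdiff_fps_linear = cdiff_fps_add cdiff_fps_cmult cdiff_fps_const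

lemma cdiff_fps_power2: "cdiff_fps (\<lambda>j. j ^ 2) = 2 * fps_X"
  by (subst cdiff_fps_rec) (simp add: cdiff2_power2 cdiff_fps_linear numeral_fps_const mult.commute)

lemma cdiff_fps_power4: "cdiff_fps (\<lambda>j. j ^ 4) = 2 * fps_X + 24 * fps_X ^ 2"
  by (subst cdiff_fps_rec)
    (simp add: cdiff2_power4 cdiff_fps_linear cdiff_fps_power2 numeral_fps_const[symmetric] power2_eq_square[of fps_X] algebra_simps)

lemma fps_const_neg_numeral: "fps_const (- numeral k) = (- numeral k :: int fps)"
  by (simp add: numeral_fps_const)

lemma fps_const_neg_one: "fps_const (- 1) = (- 1 :: int fps)"
  by (metis fps_const_1_eq_1 fps_const_neg)

lemmas fps_const_eqs = numeral_fps_const[symmetric] fps_const_neg_numeral fps_const_neg_one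

lemma nd3_0: "nd3 0 = 0"
  by (simp add: nd3_def)

text \<open>The difference relation becomes a linear equation for the series. The five relations
  form a triangular system, solved in turn; each new function raises the power of 1 + 3z by
  one.\<close>

lemma cdiff_fps_nd3: "(1 + 3 * fps_X) * cdiff_fps nd3 = 2 * fps_X"
proof -
  have "cdiff_fps nd3 = fps_X * (2 + (-3) * cdiff_fps nd3)"
    by (subst cdiff_fps_rec) (simp only: cdiff2_nd3 cdiff_fps_linear fps_const_eqs nd3_0 fps_const_0_eq_0 add_0)
  then show ?thesis by algebra
qed

lemma cdiff_fps_chi3: "(1 + 3 * fps_X) ^ 2 * cdiff_fps (\<lambda>j. j * chi3 j) = 2 * fps_X"
proof -
  have "cdiff_fps (\<lambda>j. j * chi3 j) =
      fps_X * (2 + ((-3) * cdiff_fps nd3 + (-3) * cdiff_fps (\<lambda>j. j * chi3 j)))"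
    by (subst cdiff_fps_rec)
      (simp only: cdiff2_chi3 cdiff_fps_linear fps_const_eqs mult_zero_left fps_const_0_eq_0 add_0)
  then show ?thesis using cdiff_fps_nd3 by algebra
qed

lemma cdiff_fps_power2_nd3:
  "(1 + 3 * fps_X) ^ 3 * cdiff_fps (\<lambda>j. j ^ 2 * nd3 j) =
    2 * fps_X + 18 * fps_X ^ 2 + 36 * fps_X ^ 3 + 36 * fps_X ^ 4"
proof -
  have "cdiff_fps (\<lambda>j. j ^ 2 * nd3 j) =
      fps_X * (2 * (2 * fps_X) + ((-3) * cdiff_fps (\<lambda>j. j ^ 2 * nd3 j)
        + (2 * cdiff_fps (\<lambda>j. j * chi3 j) + (2 + (-1) * cdiff_fps nd3))))"
    by (subst cdiff_fps_rec)
      (simp only: cdiff2_power2_nd3 cdiff_fps_linear cdiff_fps_power2 fps_const_eqs nd3_0 mult_zero_right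
        fps_const_0_eq_0 add_0)
  then show ?thesis using cdiff_fps_nd3 cdiff_fps_chi3 by algebra
qed

lemma cdiff_fps_power3_chi3:
  "(1 + 3 * fps_X) ^ 4 * cdiff_fps (\<lambda>j. j ^ 3 * chi3 j) = 2 * fps_X - 54 * fps_X ^ 3"
proof -
  have "cdiff_fps (\<lambda>j. j ^ 3 * chi3 j) =
      fps_X * ((-3) * cdiff_fps (\<lambda>j. j ^ 3 * chi3 j) + ((-3) * cdiff_fps (\<lambda>j. j * chi3 j)
        + (6 * (2 * fps_X) + ((-9) * cdiff_fps (\<lambda>j. j ^ 2 * nd3 j) + (2 + (-3) * cdiff_fps nd3)))))"
    by (subst cdiff_fps_rec)
      (simp only: cdiff2_power3_chi3 cdiff_fps_linear cdiff_fps_power2 fps_const_eqs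
        zero_power zero_less_numeral mult_zero_left fps_const_0_eq_0 add_0)
  then show ?thesis using cdiff_fps_nd3 cdiff_fps_chi3 cdiff_fps_power2_nd3 by algebra
qed

lemma cdiff_fps_power4_nd3:
  "(1 + 3 * fps_X) ^ 5 * cdiff_fps (\<lambda>j. j ^ 4 * nd3 j) =
    2 * fps_X + 54 * fps_X ^ 2 + 378 * fps_X ^ 3 + 1566 * fps_X ^ 4 + 4860 * fps_X ^ 5
      + 6804 * fps_X ^ 6 + 3888 * fps_X ^ 7"
proof -
  have "cdiff_fps (\<lambda>j. j ^ 4 * nd3 j) =
      fps_X * (2 * (2 * fps_X + 24 * fps_X ^ 2) + (12 * (2 * fps_X) + (2
        + ((-3) * cdiff_fps (\<lambda>j. j ^ 4 * nd3 j) + ((-6) * cdiff_fps (\<lambda>j. j ^ 2 * nd3 j)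
        + ((-1) * cdiff_fps nd3 + (4 * cdiff_fps (\<lambda>j. j ^ 3 * chi3 j)
        + 4 * cdiff_fps (\<lambda>j. j * chi3 j))))))))"
    by (subst cdiff_fps_rec)
      (simp only: cdiff2_power4_nd3 cdiff_fps_linear cdiff_fps_power2 cdiff_fps_power4 fps_const_eqs nd3_0
        mult_zero_right fps_const_0_eq_0 add_0)
  then show ?thesis
    using cdiff_fps_nd3 cdiff_fps_chi3 cdiff_fps_power2_nd3 cdiff_fps_power3_chi3 by algebra
qed


section \<open>Polynomial representatives of the difference series modulo 27\<close>

lemma cdiff_fps_nd3_mod_27:
  "27 dvd cdiff_fps nd3 - 2 * fps_X * (1 - 3 * fps_X + 9 * fps_X ^ 2)"
proof -
  \<comment> \<open>The cofactor inverts 1 + 3z modulo 27, as (1 + 3z)(1 - 3z + 9z^2) = 1 +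
    27z^3.\<close>
  have "(1 + 3 * fps_X) * (cdiff_fps nd3 - 2 * fps_X * (1 - 3 * fps_X + 9 * fps_X ^ 2)) =
      27 * (- 2 * fps_X ^ 4)"
    using cdiff_fps_nd3 by algebra
  then have "27 dvd (1 + 3 * fps_X) * (cdiff_fps nd3 - 2 * fps_X * (1 - 3 * fps_X + 9 * fps_X ^ 2))"
    by (rule dvdI)
  then show ?thesis by (rule fps_numeral_dvd_mult_cancel) simp
qed

lemma cdiff_fps_nd3_square_mod_27:
  "27 dvd cdiff_fps (\<lambda>j. nd3 j * (j ^ 2 - 1)) - 2 * fps_X * (3 * fps_X + 9 * fps_X ^ 2 - 9 * fps_X ^ 3)"
    (is "27 dvd ?e")
proof -
  have "(\<lambda>j. nd3 j * (j ^ 2 - 1)) = (\<lambda>j. j ^ 2 * nd3 j + (-1) * nd3 j)"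
    by (simp add: fun_eq_iff algebra_simps)
  then have "cdiff_fps (\<lambda>j. nd3 j * (j ^ 2 - 1)) = cdiff_fps (\<lambda>j. j ^ 2 * nd3 j) + (-1) * cdiff_fps nd3"
    by (simp only: cdiff_fps_linear fps_const_eqs)
  then have "(1 + 3 * fps_X) ^ 3 * ?e =
      27 * (- 2 * fps_X ^ 3 - 10 * fps_X ^ 4 - 18 * fps_X ^ 5 + 18 * fps_X ^ 7)"
    using cdiff_fps_nd3 cdiff_fps_power2_nd3 by algebra
  then have "27 dvd (1 + 3 * fps_X) ^ 3 * ?e" by (rule dvdI)
  then show ?thesis by (rule fps_numeral_dvd_mult_cancel) (simp add: fps_nth_power_0)
qed

lemma cdiff_fps_nd3_fourth_mod_27:
  "27 dvd cdiff_fps (\<lambda>j. nd3 j * (j ^ 2 - 1) ^ 2) - 2 * fps_X * (9 * fps_X - 9 * fps_X ^ 3)"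
    (is "27 dvd ?e")
proof -
  have "(\<lambda>j. nd3 j * (j ^ 2 - 1) ^ 2) = (\<lambda>j. j ^ 4 * nd3 j + ((-2) * (j ^ 2 * nd3 j) + nd3 j))"
    unfolding fun_eq_iff by (intro allI, algebra)
  then have "cdiff_fps (\<lambda>j. nd3 j * (j ^ 2 - 1) ^ 2) =
      cdiff_fps (\<lambda>j. j ^ 4 * nd3 j) + ((-2) * cdiff_fps (\<lambda>j. j ^ 2 * nd3 j) + cdiff_fps nd3)"
    by (simp only: cdiff_fps_linear fps_const_eqs)
  then have "(1 + 3 * fps_X) ^ 5 * ?e =
      27 * (- 4 * fps_X ^ 3 - 24 * fps_X ^ 4 - 24 * fps_X ^ 5 + 18 * fps_X ^ 6 + 162 * fps_X ^ 7
        + 270 * fps_X ^ 8 + 162 * fps_X ^ 9)"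
    using cdiff_fps_nd3 cdiff_fps_power2_nd3 cdiff_fps_power4_nd3 by algebra
  then have "27 dvd (1 + 3 * fps_X) ^ 5 * ?e" by (rule dvdI)
  then show ?thesis by (rule fps_numeral_dvd_mult_cancel) (simp add: fps_nth_power_0)
qed

section \<open>The central Eulerian numbers\<close>

text \<open>The binomial theorem cut off at y^3, which 27 divides; doubling clears the denominator
  of n choose 2.\<close>

lemma binomial_expansion_mod_27:
  fixes y :: int
  assumes "3 dvd y"
  shows "27 dvd 2 * (1 + y) ^ n - (2 + 2 * int n * y + int n * (int n - 1) * y ^ 2)"
proof (induction n)
  case (Suc n)
  obtain h where h: "2 * (1 + y) ^ n - (2 + 2 * int n * y + int n * (int n - 1) * y ^ 2) = 27 * h"
    using Suc by (auto elim: dvdE)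
  obtain k where k: "y = 3 * k" using assms by (auto elim: dvdE)
  have "2 * (1 + y) ^ Suc n - (2 + 2 * int (Suc n) * y + int (Suc n) * (int (Suc n) - 1) * y ^ 2)
      = (1 + y) * (2 * (1 + y) ^ n - (2 + 2 * int n * y + int n * (int n - 1) * y ^ 2))
        + int n * (int n - 1) * y ^ 3"
    by (simp add: power2_eq_square power3_eq_cube algebra_simps)
  also have "\<dots> = 27 * ((1 + y) * h + int n * (int n - 1) * k ^ 3)"
    unfolding h by (simp add: k power_mult_distrib algebra_simps)
  finally show ?case by simp
qed simp

text \<open>If 3 does not divide j, then j^2 = 1 + y with 3 dividing y. For multiples of 3 the
  exponent must reach 3, hence \<open>n \<ge> 2\<close>.\<close>

lemma even_power_mod_27:
  fixes j :: int
  assumes "3 dvd j \<Longrightarrow> n \<ge> 2"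
  shows "27 dvd 2 * j ^ (2 * n) -
    nd3 j * (2 + 2 * int n * (j ^ 2 - 1) + int n * (int n - 1) * (j ^ 2 - 1) ^ 2)"
proof (cases "3 dvd j")
  case True
  then have "(3::int) ^ 3 dvd j ^ 3" by (rule dvd_power_same)
  also have "j ^ 3 dvd j ^ (2 * n)" using assms True by (intro le_imp_power_dvd) auto
  finally show ?thesis using True by (simp add: nd3_def)
next
  case False
  then have "j mod 3 = 1 \<or> j mod 3 = 2" by presburger
  then have "j ^ 2 mod 3 = 1" by (auto simp: power_mod[of j 3 2, symmetric])
  then have "3 dvd j ^ 2 - 1" by presburger
  from binomial_expansion_mod_27[OF this, of n] show ?thesis
    using False by (simp add: nd3_def power_mult)
qed

lemma eulerian_central:
  "eulerian (2 * n) (n + 1) = (\<Sum>i\<le>n. (-1) ^ i * int ((2 * n + 1) choose i) * (int n + 1 - int i) ^ (2 * n))"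
proof (cases "n = 0")
  case True
  then show ?thesis by (simp add: eulerian_def)
next
  case False
  have "eulerian (2 * n) (n + 1) =
      (\<Sum>j=0..n + 1. (-1) ^ (n + 1 - j) * int ((2 * n + 1) choose (n + 1 - j)) * int j ^ (2 * n))"
    using False by (simp add: eulerian_def)
  also have "\<dots> = (\<Sum>i=0..n + 1. (-1) ^ i * int ((2 * n + 1) choose i) * int (n + 1 - i) ^ (2 * n))"
    by (subst sum.atLeastAtMost_rev) (intro sum.cong, auto)
  \<comment> \<open>The dropped term i = n+1 is a multiple of 0^(2n), which is 0 only for n > 0; the
    case n = 0 rests on the convention A(0,1) = 1.\<close>
  also have "\<dots> = (\<Sum>i\<le>n. (-1) ^ i * int ((2 * n + 1) choose i) * int (n + 1 - i) ^ (2 * n))"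
    using False by (simp add: atLeast0AtMost)
  also have "\<dots> = (\<Sum>i\<le>n. (-1) ^ i * int ((2 * n + 1) choose i) * (int n + 1 - int i) ^ (2 * n))"
    by (intro sum.cong) (simp_all add: of_nat_diff add.commute)
  finally show ?thesis .
qed

text \<open>On coefficients, z d/dz is multiplication by n and z^2 d^2/dz^2 by n(n-1), so the
  quadratic expansion of j^(2n) can be summed termwise.\<close>

lemma eulerian_fps_mod_27:
  "27 dvd 2 * Abs_fps (\<lambda>n. eulerian (2 * n) (n + 1)) -
    (2 * half_alt_fps nd3 + 2 * fps_X * fps_deriv (half_alt_fps (\<lambda>j. nd3 j * (j ^ 2 - 1)))
      + fps_X ^ 2 * fps_deriv (fps_deriv (half_alt_fps (\<lambda>j. nd3 j * (j ^ 2 - 1) ^ 2))))"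
    (is "27 dvd ?f")
proof -
  have d1: "fps_nth (2 * fps_X * fps_deriv h) n = 2 * int n * fps_nth h n" for h :: "int fps" and n
    by (cases n) (simp_all add: mult.assoc numeral_fps_const)
  have d2: "fps_nth (fps_X ^ 2 * fps_deriv (fps_deriv h)) n = int n * (int n - 1) * fps_nth h n"
    for h :: "int fps" and n
  proof (cases "n < 2")
    case True
    then have "n = 0 \<or> n = 1" by linarith
    then show ?thesis by (auto simp: fps_X_power_mult_nth)
  next
    case False
    then obtain m where "n = m + 2" by (metis le_add_diff_inverse2 not_less)
    then show ?thesis by (simp add: fps_X_power_mult_nth)
  qed
  have "27 dvd fps_nth ?f n" for n
  proof -
    let ?b = "\<lambda>i. (-1) ^ i * int ((2 * n + 1) choose i)"
    let ?j = "\<lambda>i. int n + 1 - int i"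
    have "fps_nth ?f n = 2 * (\<Sum>i\<le>n. ?b i * ?j i ^ (2 * n)) - (2 * (\<Sum>i\<le>n. ?b i * nd3 (?j i))
        + 2 * int n * (\<Sum>i\<le>n. ?b i * (nd3 (?j i) * (?j i ^ 2 - 1)))
        + int n * (int n - 1) * (\<Sum>i\<le>n. ?b i * (nd3 (?j i) * (?j i ^ 2 - 1) ^ 2)))"
      unfolding fps_sub_nth fps_add_nth d1 d2
      by (simp only: eulerian_central half_alt_fps_def numeral_fps_const fps_mult_left_const_nth fps_nth_Abs_fps)
    also have "\<dots> = (\<Sum>i\<le>n. ?b i * (2 * ?j i ^ (2 * n) - nd3 (?j i) *
        (2 + 2 * int n * (?j i ^ 2 - 1) + int n * (int n - 1) * (?j i ^ 2 - 1) ^ 2)))"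
      unfolding sum_distrib_left sum.distrib[symmetric] sum_subtractf[symmetric]
      by (intro sum.cong refl) algebra
    finally have eq: "fps_nth ?f n = \<dots>" .
    \<comment> \<open>The argument n+1-i is positive, so as a multiple of 3 it is at least
      3.\<close>
    have "3 dvd ?j i \<Longrightarrow> n \<ge> 2" if "i \<le> n" for i
      using zdvd_imp_le[of 3 "?j i"] that by linarith
    then show ?thesis unfolding eq by (intro dvd_sum dvd_mult even_power_mod_27) auto
  qed
  then show ?thesis unfolding fps_numeral_dvd_iff by blast
qed

section \<open>Assembly of the congruence\<close>

lemma fps_numeral_dvd_deriv: "numeral k dvd f \<Longrightarrow> numeral k dvd fps_deriv (f :: int fps)"
  by (simp add: fps_numeral_dvd_iff)

lemma nd3_minus: "nd3 (- j) = nd3 j"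
  by (simp add: nd3_def)

lemma eulerian_fps_cbin_mod_27:
  "27 dvd Abs_fps (\<lambda>n. eulerian (2 * n) (n + 1)) -
    (14 + 3 * (3 * fps_X ^ 2 - 4 * fps_X + 2) * cbin
         + (21 * fps_X ^ 3 + 20 * fps_X ^ 2 + 13 * fps_X + 23) * cbin ^ 3
         + 3 * (6 * fps_X ^ 4 + 4 * fps_X ^ 3 + 3 * fps_X ^ 2 + 4) * cbin ^ 5)"
    (is "27 dvd ?E - ?V")
proof -
  define N0 N1 N2 where "N0 = half_alt_fps nd3"
    and "N1 = half_alt_fps (\<lambda>j. nd3 j * (j ^ 2 - 1))"
    and "N2 = half_alt_fps (\<lambda>j. nd3 j * (j ^ 2 - 1) ^ 2)"
  let ?W = "1 + (1 + 4 * fps_X) * cbin"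
  let ?R0 = "1 - 3 * fps_X + 9 * fps_X ^ 2 :: int fps"
  let ?R1 = "3 * fps_X + 9 * fps_X ^ 2 - 9 * fps_X ^ 3 :: int fps"
  let ?R2 = "9 * fps_X - 9 * fps_X ^ 3 :: int fps"
  have N0: "27 dvd 2 * N0 - ?W * ?R0" unfolding N0_def
    by (rule half_alt_fps_mod_27) (simp_all only: nd3_minus nd3_0 cdiff_fps_nd3_mod_27)
  have "27 dvd 2 * N1 - ?W * ?R1" unfolding N1_def
    by (rule half_alt_fps_mod_27) (simp_all only: nd3_minus nd3_0 cdiff_fps_nd3_square_mod_27 power2_minus mult_zero_left)
  then have N1: "27 dvd fps_deriv (2 * N1 - ?W * ?R1)" by (rule fps_numeral_dvd_deriv)
  have "27 dvd 2 * N2 - ?W * ?R2" unfolding N2_def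
    by (rule half_alt_fps_mod_27) (simp_all only: nd3_minus nd3_0 cdiff_fps_nd3_fourth_mod_27 power2_minus mult_zero_left)
  then have N2: "27 dvd fps_deriv (fps_deriv (2 * N2 - ?W * ?R2))" by (intro fps_numeral_dvd_deriv)
  have W': "fps_deriv ?W = 2 * cbin"
    using cbin_ode by (simp add: algebra_simps)
  have E: "27 dvd 2 * ?E - (2 * N0 + 2 * fps_X * fps_deriv N1 + fps_X ^ 2 * fps_deriv (fps_deriv N2))"
    unfolding N0_def N1_def N2_def by (rule eulerian_fps_mod_27)
  have two: "fps_deriv (2 * f) = 2 * fps_deriv f" for f :: "int fps"
    by simp
  have R1': "fps_deriv ?R1 = 3 + 18 * fps_X - 27 * fps_X ^ 2"
    by (simp add: fps_deriv_power numeral_fps_const[symmetric])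
  have R2': "fps_deriv ?R2 = 9 - 27 * fps_X ^ 2"
    by (simp add: fps_deriv_power numeral_fps_const[symmetric])
  have R2'': "fps_deriv (9 - 27 * fps_X ^ 2) = (- 54 * fps_X :: int fps)"
    by (simp add: fps_deriv_power numeral_fps_const[symmetric])
  have D1: "fps_deriv (2 * N1 - ?W * ?R1) = 2 * fps_deriv N1 -
      (2 * cbin * ?R1 + ?W * (3 + 18 * fps_X - 27 * fps_X ^ 2))"
    unfolding fps_deriv_sub[of "2 * N1"] two fps_deriv_mult[of ?W] W' R1' by (simp only: add.commute)
  have D2: "fps_deriv (fps_deriv (2 * N2 - ?W * ?R2)) = 2 * fps_deriv (fps_deriv N2) -
      (- 4 * cbin ^ 3 * ?R2 + 4 * cbin * (9 - 27 * fps_X ^ 2) + ?W * (- 54 * fps_X))"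
    unfolding fps_deriv_sub[of "2 * N2"] two fps_deriv_sub[of "2 * fps_deriv N2"]
      fps_deriv_add[of "?W * (9 - 27 * fps_X ^ 2)"]
      fps_deriv_mult[of ?W] W' R2' fps_deriv_mult[of "2 * cbin"] cbin_deriv R2''
    by algebra
  obtain e where e: "2 * ?E - (2 * N0 + 2 * fps_X * fps_deriv N1 + fps_X ^ 2 * fps_deriv (fps_deriv N2)) = 27 * e"
    using E by (auto elim: dvdE)
  obtain a where a: "2 * N0 - ?W * ?R0 = 27 * a" using N0 by (auto elim: dvdE)
  obtain b where b: "2 * fps_deriv N1 - (2 * cbin * ?R1 + ?W * (3 + 18 * fps_X - 27 * fps_X ^ 2)) = 27 * b"
    using N1 unfolding D1 by (auto elim: dvdE)
  obtain c where c: "2 * fps_deriv (fps_deriv N2) -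
      (- 4 * cbin ^ 3 * ?R2 + 4 * cbin * (9 - 27 * fps_X ^ 2) + ?W * (- 54 * fps_X)) = 27 * c"
    using N2 unfolding D2 by (auto elim: dvdE)
  let ?S1 = "2 * cbin * ?R1 + ?W * (3 + 18 * fps_X - 27 * fps_X ^ 2)"
  let ?S2 = "- 4 * cbin ^ 3 * ?R2 + 4 * cbin * (9 - 27 * fps_X ^ 2) + ?W * (- 54 * fps_X)"
  \<comment> \<open>\<open>T\<close> is 4 \<open>?E\<close> modulo 27: one factor 2 comes from the
    doubled binomial expansion, the other from \<open>half_alt_fps_mod_27\<close>.\<close>
  define T where "T = 2 * (?W * ?R0) + 2 * fps_X * ?S1 + fps_X ^ 2 * ?S2"
  have lin: "4 * E = 2 * (2 * E - (2 * n0 + 2 * x * n1 + x ^ 2 * n2)) + 2 * (2 * n0 - s0)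
      + 2 * x * (2 * n1 - s1) + x ^ 2 * (2 * n2 - s2) + (2 * s0 + 2 * x * s1 + x ^ 2 * s2)"
    for E x n0 n1 n2 s0 s1 s2 :: "int fps"
    by algebra
  have "4 * ?E = 2 * (27 * e) + 2 * (27 * a) + 2 * fps_X * (27 * b) + fps_X ^ 2 * (27 * c) + T"
    unfolding T_def e[symmetric] a[symmetric] b[symmetric] c[symmetric] by (rule lin)
  then have "4 * ?E = T + 27 * (2 * e + 2 * a + 2 * fps_X * b + fps_X ^ 2 * c)"
    by algebra
  \<comment> \<open>The factor (1 + 4z)^2 lowers \<open>cbin ^ 5\<close> and \<open>cbin ^ 3\<close>
    to multiples of \<open>cbin\<close>, leaving a polynomial plus a polynomial times
    \<open>cbin\<close>.\<close>
  moreover have "(1 + 4 * fps_X) ^ 2 * (T - 4 * ?V) =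
      27 * ((1 + 4 * fps_X) ^ 2 * (- 2 + 2 * fps_X ^ 2 - 4 * fps_X ^ 3)
       + cbin * (- 6 - 20 * fps_X - 6 * fps_X ^ 2 + 40 * fps_X ^ 3 + 40 * fps_X ^ 4 - 84 * fps_X ^ 5
         - 336 * fps_X ^ 6))"
    unfolding T_def using cbin_square by algebra
  moreover have "4 * q * (E - R) = q * (4 * E - T) + q * (T - 4 * R)" for q E R :: "int fps"
    by algebra
  ultimately have "4 * (1 + 4 * fps_X) ^ 2 * (?E - ?V) =
      27 * ((1 + 4 * fps_X) ^ 2 * (2 * e + 2 * a + 2 * fps_X * b + fps_X ^ 2 * c)
       + ((1 + 4 * fps_X) ^ 2 * (- 2 + 2 * fps_X ^ 2 - 4 * fps_X ^ 3)
       + cbin * (- 6 - 20 * fps_X - 6 * fps_X ^ 2 + 40 * fps_X ^ 3 + 40 * fps_X ^ 4 - 84 * fps_X ^ 5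
         - 336 * fps_X ^ 6)))"
    by (simp only: add_diff_cancel_left' distrib_left mult.left_commute[of 27])
  then have "27 dvd 4 * (1 + 4 * fps_X) ^ 2 * (?E - ?V)" by (rule dvdI)
  then show ?thesis
    by (rule fps_numeral_dvd_mult_cancel) (simp add: fps_nth_power_0 numeral_fps_const
      coprime_iff_gcd_eq_1 gcd_non_0_int)
qed

theorem theorem18p7:
  shows "\<forall>m. (27::int) dvd fps_nth
     (Abs_fps (\<lambda>n. eulerian (2 * n) (n + 1))
      - (14 + 3 * (3 * fps_X ^ 2 - 4 * fps_X + 2) * Psi
         + (21 * fps_X ^ 3 + 20 * fps_X ^ 2 + 13 * fps_X + 23) * Psi ^ 3
         + 3 * (6 * fps_X ^ 4 + 4 * fps_X ^ 3 + 3 * fps_X ^ 2 + 4) * Psi ^ 5)) m"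
proof -
  let ?a = "3 * fps_X ^ 2 - 4 * fps_X + 2 :: int fps"
  let ?b = "21 * fps_X ^ 3 + 20 * fps_X ^ 2 + 13 * fps_X + 23 :: int fps"
  let ?c = "6 * fps_X ^ 4 + 4 * fps_X ^ 3 + 3 * fps_X ^ 2 + 4 :: int fps"
  let ?E = "Abs_fps (\<lambda>n. eulerian (2 * n) (n + 1))"
  \<comment> \<open>This is the cancellation condition of \<open>quintic_combination_mod_27\<close>,
    with the even powers of \<open>cbin\<close> cleared by (1 + 4z)^2.\<close>
  have "(1 + 4 * fps_X) ^ 2 * (?a + ?b * cbin ^ 2 + 5 * ?c * cbin ^ 4) =
      3 * (15 + 39 * fps_X + 30 * fps_X ^ 2 + 27 * fps_X ^ 3 + 54 * fps_X ^ 4)"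
    using cbin_square by algebra
  then have "3 dvd (1 + 4 * fps_X) ^ 2 * (?a + ?b * cbin ^ 2 + 5 * ?c * cbin ^ 4)" by (rule dvdI)
  then have "3 dvd ?a + ?b * cbin ^ 2 + 5 * ?c * cbin ^ 4"
    by (rule fps_numeral_dvd_mult_cancel) (simp add: fps_nth_power_0)
  then have "27 dvd (3 * ?a * Psi + ?b * Psi ^ 3 + 3 * ?c * Psi ^ 5)
      - (3 * ?a * cbin + ?b * cbin ^ 3 + 3 * ?c * cbin ^ 5)"
    by (rule quintic_combination_mod_27[OF Psi_cbin_mod_3])
  note diff = dvd_diff[OF eulerian_fps_cbin_mod_27 this]
  have "e - (k + x + y + z) - ((x' + y' + z') - (x + y + z)) = e - (k + x' + y' + z')"
    for e k x y z x' y' z' :: "int fps"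
    by simp
  from diff[unfolded this]
  have "27 dvd ?E - (14 + 3 * ?a * Psi + ?b * Psi ^ 3 + 3 * ?c * Psi ^ 5)" .
  then show ?thesis unfolding fps_numeral_dvd_iff by blast
qed

end
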